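(* Let $(P_n)_{n\ge 1}$ be an ultraflat sequence of polynomials $P_n \in \mathcal{K}_n$, and write $P_n(z)=\sum_{k=0}^n a_{k,n}z^k$. Then $$\sum_{k=0}^n k^2\left|a_{k,n}-\overline{a}_{n-k,n}\right|^2 = \frac{1}{2\pi}\int_0^{2\pi}\left|(P_n' - P_n^{*\prime})(e^{it})\right|^2\,dt \;\sim\; \frac{2n^3}{3}\,.$$
   Context: For $n \ge 1$, $\mathcal{K}_n$ is the set of polynomials $p(z)=\sum_{k=0}^n a_k z^k$ with $a_k\in\mathbb{C}$ and $|a_k|=1$ for all $k=0,\dots,n$. A sequence $(P_n)_{n\ge1}$ with $P_n\in\mathcal{K}_n$ is called ultraflat if there is a sequence $(\varepsilon_n)$ of positive numbers tending to $0$ such that $(1-\varepsilon_n)\sqrt{n+1}\le |P_n(e^{it})|\le (1+\varepsilon_n)\sqrt{n+1}$ for all $t\in\mathbb{R}$ and all $n$. For $P(z)=\sum_{k=0}^n a_k z^k$ of degree $n$, the conjugate reciprocal polynomial is $P^*(z):=\sum_{k=0}^n \overline{a}_{n-k}z^k$. $P_n'$ and $P_n^{*\prime}$ are the derivatives of the polynomials $P_n$ and $P_n^*$ with respect to $z$. The symbol $\sim$ means that the ratio of the left and right hand sides converges to $1$ as $n\to\infty$. *)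

theory Defs
  imports "HOL-Analysis.Analysis" "HOL-Computational_Algebra.Polynomial"
    "HOL-Library.Landau_Symbols"
begin

unbundle asymp_equiv_syntax

definition unimodular_polys :: "nat \<Rightarrow> complex poly set" where
  "unimodular_polys n = {p. degree p \<le> n \<and> (\<forall>k\<le>n. cmod (coeff p k) = 1)}"

text \<open>Sequences are indexed by \<open>n \<ge> 1\<close>; the entries at index \<open>0\<close> are irrelevant.\<close>

definition ultraflat :: "(nat \<Rightarrow> complex poly) \<Rightarrow> bool" where
  "ultraflat P \<longleftrightarrow>
    (\<forall>n\<ge>1. P n \<in> unimodular_polys n) \<and>
    (\<exists>\<epsilon> :: nat \<Rightarrow> real. (\<forall>n\<ge>1. \<epsilon> n > 0) \<and> \<epsilon> \<longlonglongrightarrow> 0 \<and>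
      (\<forall>n\<ge>1. \<forall>t::real.
        (1 - \<epsilon> n) * sqrt (real n + 1) \<le> cmod (poly (P n) (exp (\<i> * complex_of_real t))) \<and>
        cmod (poly (P n) (exp (\<i> * complex_of_real t))) \<le> (1 + \<epsilon> n) * sqrt (real n + 1)))"

definition conj_reciprocal :: "complex poly \<Rightarrow> complex poly" where
  "conj_reciprocal p = (\<Sum>k\<le>degree p. monom (cnj (coeff p (degree p - k))) k)"

end

theory Submission
  imports Defs "HOL-Complex_Analysis.Riemann_Mapping"
begin

text \<open>
  Expanding the square gives \<open>2 \<Sum> k\<^sup>2 - 2 Re \<Sum> k\<^sup>2 c\<^sub>k\<close> with \<open>c\<^sub>k = a\<^sub>k a\<^sub>n\<^sub>-\<^sub>k\<close>, so the claim is that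
  \<open>\<Sum> k\<^sup>2 c\<^sub>k = o(n\<^sup>3)\<close>. Flatness extends off the unit circle: \<open>P P\<^sup>* - (n + 1) z\<^sup>n\<close> is small for
  \<open>\<bar>z\<bar>\<^sup>n\<close> in any fixed compact subset of \<open>(0, \<infinity>)\<close>, hence \<open>P\<close> has no zeros there.
  For \<open>\<bar>w\<bar> = 1\<close> the even function \<open>P (w exp (i z / n)) P (w exp (- i z / n)) / P (w)\<^sup>2\<close> of \<open>z\<close> therefore has a
  logarithm in a large disc \<open>\<bar>z\<bar> < R\<close>, with real part \<open>O(R)\<close> and a double zero at \<open>0\<close>, so by a second-order
  Schwarz lemma the function is \<open>1 + O(1 / R)\<close> at any fixed \<open>z = s\<close>. Comparing coefficients of \<open>z\<^sup>n\<close>,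
  \<open>\<Sum> c\<^sub>k (exp (i s y\<^sub>k) - 1) = o(n)\<close> for \<open>y\<^sub>k = 2 k / n - 1\<close> and every real \<open>s\<close>. Averaging over
  \<open>s = 0, \<dots>, M - 1\<close> yields \<open>\<Sum> c\<^sub>k = o(n)\<close>, and approximating \<open>y\<^sup>2\<close> by \<open>2 (1 - cos (s y)) / s\<^sup>2\<close> with small \<open>s\<close>
  yields \<open>\<Sum> c\<^sub>k y\<^sub>k\<^sup>2 = o(n)\<close>. Since \<open>\<Sum> c\<^sub>k y\<^sub>k = 0\<close> by symmetry, \<open>\<Sum> k\<^sup>2 c\<^sub>k = o(n\<^sup>3)\<close>.
\<close>

subsection \<open>Schwarz and Borel--Caratheodory estimates\<close>

text \<open>Dividing by \<open>z\<close> leaves a map \<open>h\<close> of the disc into itself with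
  \<open>h 0 = deriv f 0 = 0\<close>, so the Schwarz lemma applies a second time.\<close>

lemma Schwarz_second_order:
  fixes f :: "complex \<Rightarrow> complex"
  assumes holf: "f holomorphic_on ball 0 1" and f0: "f 0 = 0" and df0: "deriv f 0 = 0"
    and less: "\<And>z. norm z < 1 \<Longrightarrow> norm (f z) < 1"
    and z: "norm z < 1"
  shows "norm (f z) \<le> (norm z)\<^sup>2"
proof -
  obtain h where holh: "h holomorphic_on ball 0 1"
    and h: "\<And>z. norm z < 1 \<Longrightarrow> f z = z * h z" and h0: "deriv f 0 = h 0"
    using Schwarz3[OF holf f0] by metis
  \<comment> \<open>The second application needs \<open>norm (h w) < 1\<close> strictly. Equality at
    one point would make \<open>f\<close> a rotation, whose derivative at 0 has modulus 1.\<close>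
  have strict: "norm (f w) < norm w" if w: "norm w < 1" "w \<noteq> 0" for w
  proof (rule ccontr)
    assume "\<not> norm (f w) < norm w"
    then have "norm (f w) = norm w"
      using Schwarz_Lemma(1)[OF holf f0 less w(1)] by simp
    then obtain a where a: "\<And>z. norm z < 1 \<Longrightarrow> f z = a * z" "norm a = 1"
      using Schwarz_Lemma(3)[OF holf f0 less w(1)] w by blast
    have "((\<lambda>z. a * z) has_field_derivative a) (at 0)"
      by (auto intro!: derivative_eq_intros)
    then have "(f has_field_derivative a) (at 0)"
      by (rule has_field_derivative_transform_within_open[where S = "ball 0 1"]) (use a in auto)
    then show False
      using df0 a(2) DERIV_imp_deriv by fastforce
  qed
  have "norm (h w) < 1" if "norm w < 1" for w
  proof (cases "w = 0")
    case False
    then have "norm w * norm (h w) < norm w * 1"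
      using strict[OF that] h[OF that] by (simp add: norm_mult)
    then show ?thesis
      using False mult_less_cancel_left_pos[of "norm w" "norm (h w)" 1] by simp
  qed (use h0 df0 in simp)
  then have "norm (h z) \<le> norm z"
    using Schwarz_Lemma(1)[OF holh] h0 df0 z by simp
  then show ?thesis
    using h[OF z] by (simp add: norm_mult power2_eq_square mult_left_mono)
qed

text \<open>Borel--Caratheodory for the logarithm, with quadratic decay because the
  logarithmic derivative of an even function vanishes at the origin.\<close>

lemma even_nonvanishing_close_to_1:
  fixes F :: "complex \<Rightarrow> complex"
  assumes holF: "F holomorphic_on ball 0 1" and F0: "F 0 = 1"
    and even: "\<And>z. norm z < 1 \<Longrightarrow> F (- z) = F z"
    and nz: "\<And>z. norm z < 1 \<Longrightarrow> F z \<noteq> 0"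
    and bound: "\<And>z. norm z < 1 \<Longrightarrow> norm (F z) < exp M"
    and z: "norm z < 1"
  obtains u where "F z = exp u" and "norm u \<le> 2 * M * (norm z)\<^sup>2 / (1 - (norm z)\<^sup>2)"
proof -
  have M: "0 < M"
    using bound[of 0] F0 by simp
  have "\<exists>E. E holomorphic_on ball 0 1 \<and> (\<forall>z\<in>ball 0 1. F z = exp (E z))"
    using simply_connected_eq_holomorphic_log[of "ball 0 1"] holF nz
      convex_imp_simply_connected[of "ball (0::complex) 1"] by auto
  then obtain E0 where holE0: "E0 holomorphic_on ball 0 1"
    and E0: "\<And>z. norm z < 1 \<Longrightarrow> F z = exp (E0 z)" by auto
  \<comment> \<open>Since \<open>F 0 = 1\<close>, also \<open>exp (E0 0) = 1\<close>, so the shifted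
    function is still a logarithm of \<open>F\<close> and now vanishes at 0.\<close>
  define E where "E z = E0 z - E0 0" for z
  have holE: "E holomorphic_on ball 0 1"
    unfolding E_def by (intro holomorphic_intros holE0)
  have E: "F z = exp (E z)" if "norm z < 1" for z
    using E0[OF that] E0[of 0] F0 by (simp add: E_def exp_diff)
  have E_0: "E 0 = 0"
    by (simp add: E_def)
  have dE: "(E has_field_derivative deriv E 0) (at 0)"
    by (rule holomorphic_derivI[OF holE]) auto
  have "((\<lambda>z. exp (E z)) has_field_derivative deriv E 0) (at 0)"
    using dE E_0 by (auto intro!: derivative_eq_intros)
  then have dF: "(F has_field_derivative deriv E 0) (at 0)"
    by (rule has_field_derivative_transform_within_open[where S = "ball 0 1"]) (use E in auto)
  have "((\<lambda>z. F (- z)) has_field_derivative - deriv E 0) (at 0)"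
    using DERIV_chain2[of F "deriv E 0" "\<lambda>z. - z" 0 "-1" UNIV] dF
      DERIV_minus[OF DERIV_ident[where F = "at (0::complex)"]] by simp
  then have "(F has_field_derivative - deriv E 0) (at 0)"
    by (rule has_field_derivative_transform_within_open[where S = "ball 0 1"]) (use even in auto)
  then have "deriv E 0 = - deriv E 0"
    using dF DERIV_unique by blast
  then have dE0: "deriv E 0 = 0"
    by simp
  have Re_E: "Re (E z) < M" if "norm z < 1" for z
    using bound[OF that] E[OF that] by simp
  have ne: "2 * complex_of_real M - E z \<noteq> 0" if "norm z < 1" for z
    using Re_E[OF that] M by (auto simp: complex_eq_iff)
  \<comment> \<open>The Moebius map fixing 0 that takes the half-plane \<open>Re < M\<close> to the
    unit disc turns the one-sided bound on \<open>Re (E z)\<close> into the hypothesis of the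
    Schwarz lemma.\<close>
  define \<phi> where "\<phi> z = E z / (2 * complex_of_real M - E z)" for z
  have hol\<phi>: "\<phi> holomorphic_on ball 0 1"
    unfolding \<phi>_def by (intro holomorphic_intros holE) (use ne in auto)
  have "(\<phi> has_field_derivative 0) (at 0)"
    unfolding \<phi>_def by (rule derivative_eq_intros dE refl)+ (use M E_0 dE0 in auto)
  then have d\<phi>: "deriv \<phi> 0 = 0"
    by (rule DERIV_imp_deriv)
  have "norm (\<phi> w) < 1" if w: "norm w < 1" for w
  proof -
    have "(norm (2 * complex_of_real M - E w))\<^sup>2 - (norm (E w))\<^sup>2 = 4 * M * (M - Re (E w))"
      unfolding cmod_power2 by (simp add: power2_eq_square algebra_simps)
    also have "\<dots> > 0"
      using M Re_E[OF w] by simp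
    finally have "norm (E w) < norm (2 * complex_of_real M - E w)"
      by (simp add: power_less_imp_less_base)
    then show ?thesis
      using ne[OF w] by (simp add: \<phi>_def norm_divide)
  qed
  then have "norm (\<phi> z) \<le> (norm z)\<^sup>2"
    using Schwarz_second_order[OF hol\<phi> _ d\<phi> _ z] E_0 by (simp add: \<phi>_def)
  then have "norm (E z) \<le> (norm z)\<^sup>2 * norm (2 * complex_of_real M - E z)"
    using ne[OF z] by (simp add: \<phi>_def norm_divide divide_le_eq)
  also have "\<dots> \<le> (norm z)\<^sup>2 * (2 * M + norm (E z))"
    using norm_triangle_ineq4[of "2 * complex_of_real M" "E z"] M
    by (intro mult_left_mono) (auto simp: norm_mult)
  finally have "norm (E z) * (1 - (norm z)\<^sup>2) \<le> 2 * M * (norm z)\<^sup>2"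
    by (simp add: algebra_simps)
  moreover have "0 < 1 - (norm z)\<^sup>2"
    using z by (simp add: power_less_one_iff)
  ultimately have le: "norm (E z) \<le> 2 * M * (norm z)\<^sup>2 / (1 - (norm z)\<^sup>2)"
    by (simp add: pos_le_divide_eq)
  show thesis
    using that[OF E[OF z] le] .
qed

subsection \<open>Polynomials on the unit circle\<close>

lemma has_integral_exp_circle:
  "((\<lambda>t. exp (\<i> * of_int m * complex_of_real t)) has_integral (if m = 0 then 2 * pi else 0)) {0..2 * pi}"
proof (cases "m = 0")
  case True
  then show ?thesis
    using has_integral_const_real[of "1::complex" 0 "2 * pi"] by (simp add: scaleR_conv_of_real)
next
  case False
  let ?F = "\<lambda>t. exp (\<i> * of_int m * complex_of_real t) / (\<i> * of_int m)"
  have "((\<lambda>t. exp (\<i> * of_int m * complex_of_real t)) has_integral ?F (2 * pi) - ?F 0) {0..2 * pi}"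
  proof (rule fundamental_theorem_of_calculus)
    fix t :: real
    have "((\<lambda>z. exp (\<i> * of_int m * z) / (\<i> * of_int m)) has_field_derivative
        exp (\<i> * of_int m * complex_of_real t)) (at (complex_of_real t))"
      by (rule derivative_eq_intros refl)+ (use False in auto)
    from has_vector_derivative_real_field[OF this]
    show "(?F has_vector_derivative exp (\<i> * of_int m * complex_of_real t)) (at t within {0..2 * pi})"
      by simp
  qed simp
  moreover have "exp (\<i> * of_int m * complex_of_real (2 * pi)) = 1"
    using exp_integer_2pi[of "of_int m"] by (simp add: mult_ac)
  ultimately show ?thesis
    using False by simp
qed

lemma exp_mult_cnj_exp_circle:
  "exp (\<i> * complex_of_real t) ^ j * cnj (exp (\<i> * complex_of_real t) ^ k)
    = exp (\<i> * of_int (int j - int k) * complex_of_real t)"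
  by (simp add: exp_cnj flip: exp_of_nat_mult exp_add)
    (simp add: algebra_simps)

lemma poly_altdef_le:
  fixes p :: "'a::comm_semiring_1 poly"
  assumes "degree p \<le> N"
  shows "poly p x = (\<Sum>k\<le>N. coeff p k * x ^ k)"
  unfolding poly_altdef
  by (rule sum.mono_neutral_left) (use assms in \<open>auto simp: coeff_eq_0\<close>)

text \<open>The squared modulus expands into a double sum of exponentials, of which only the
  diagonal survives integration.\<close>

lemma parseval_poly:
  fixes p :: "complex poly"
  assumes deg: "degree p \<le> N"
  shows "((\<lambda>t. (cmod (poly p (exp (\<i> * complex_of_real t))))\<^sup>2) has_integral
    2 * pi * (\<Sum>k\<le>N. (cmod (coeff p k))\<^sup>2)) {0..2 * pi}"
proof -
  let ?e = "\<lambda>t. exp (\<i> * complex_of_real t)"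
  let ?f = "\<lambda>t. \<Sum>j\<le>N. \<Sum>k\<le>N. coeff p j * cnj (coeff p k) *
      exp (\<i> * of_int (int j - int k) * complex_of_real t)"
  have eq: "(cmod (poly p (?e t)))\<^sup>2 = Re (?f t)" for t
  proof -
    have "complex_of_real ((cmod (poly p (?e t)))\<^sup>2) = poly p (?e t) * cnj (poly p (?e t))"
      by (rule complex_norm_square)
    also have "\<dots> = (\<Sum>j\<le>N. \<Sum>k\<le>N. coeff p j * cnj (coeff p k) * (?e t ^ j * cnj (?e t ^ k)))"
      by (simp add: poly_altdef_le[OF deg] sum_product cnj_sum mult_ac)
    also have "\<dots> = ?f t"
      by (simp only: exp_mult_cnj_exp_circle)
    finally show ?thesis
      by (metis Re_complex_of_real)
  qed
  have "(?f has_integral (\<Sum>j\<le>N. \<Sum>k\<le>N. coeff p j * cnj (coeff p k) *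
      (if int j - int k = 0 then 2 * pi else 0))) {0..2 * pi}"
    by (intro has_integral_sum has_integral_mult_right has_integral_exp_circle) auto
  also have "(\<Sum>j\<le>N. \<Sum>k\<le>N. coeff p j * cnj (coeff p k) *
      complex_of_real (if int j - int k = 0 then 2 * pi else 0))
    = (\<Sum>j\<le>N. \<Sum>k\<le>N. if j = k then 2 * pi * (coeff p k * cnj (coeff p k)) else 0)"
    by (intro sum.cong) auto
  also have "\<dots> = complex_of_real (2 * pi * (\<Sum>k\<le>N. (cmod (coeff p k))\<^sup>2))"
    by (simp add: sum_distrib_left flip: complex_norm_square)
  finally have "((Re \<circ> ?f) has_integral Re (complex_of_real (2 * pi * (\<Sum>k\<le>N. (cmod (coeff p k))\<^sup>2)))) {0..2 * pi}"
    by (rule has_integral_linear[OF _ bounded_linear_Re])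
  moreover have "Re \<circ> ?f = (\<lambda>t. (cmod (poly p (?e t)))\<^sup>2)"
    using eq by (intro ext) simp
  ultimately show ?thesis
    by (simp only: Re_complex_of_real)
qed

text \<open>By Parseval, the mean of the squared modulus over the circle dominates each single
  squared coefficient.\<close>

lemma coeff_le_of_unit_circle_bound:
  fixes p :: "complex poly"
  assumes circle: "\<And>w. cmod w = 1 \<Longrightarrow> cmod (poly p w) \<le> c"
  shows "cmod (coeff p k) \<le> c"
proof -
  have c: "0 \<le> c"
    using circle[of 1] order_trans[OF norm_ge_zero] by auto
  \<comment> \<open>The maximum keeps the index \<open>k\<close> in the sum even when it exceeds the
    degree.\<close>
  let ?N = "max k (degree p)"
  have "2 * pi * (\<Sum>j\<le>?N. (cmod (coeff p j))\<^sup>2) \<le> c\<^sup>2 * (2 * pi)"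
  proof (rule has_integral_le[OF parseval_poly])
    show "((\<lambda>t. c\<^sup>2) has_integral c\<^sup>2 * (2 * pi)) {0..2 * pi}"
      using has_integral_const_real[of "c\<^sup>2" 0 "2 * pi"] by (simp add: mult.commute)
  qed (use circle c in \<open>auto intro!: power_mono\<close>)
  moreover have "(cmod (coeff p k))\<^sup>2 \<le> (\<Sum>j\<le>?N. (cmod (coeff p j))\<^sup>2)"
    by (rule member_le_sum[of k]) auto
  ultimately have "(cmod (coeff p k))\<^sup>2 \<le> c\<^sup>2"
    by (simp add: mult.commute)
  then show ?thesis
    using c by (rule power2_le_imp_le)
qed

text \<open>In the disc this is the maximum principle. Outside, the same principle is applied to the
  reflected polynomial at \<open>inverse x\<close>, at the cost of a factor
  \<open>cmod x ^ degree p\<close>.\<close>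

lemma poly_unit_circle_growth:
  fixes p :: "complex poly"
  assumes deg: "degree p \<le> N" and circle: "\<And>w. cmod w = 1 \<Longrightarrow> cmod (poly p w) \<le> c"
  shows "cmod (poly p x) \<le> c * (max 1 (cmod x)) ^ N"
proof -
  have disc: "cmod (poly q x) \<le> c"
    if "\<And>w. cmod w = 1 \<Longrightarrow> cmod (poly q w) \<le> c" "cmod x \<le> 1" for q x
    by (rule maximum_modulus_frontier[of "poly q" "cball 0 1"])
      (use that in \<open>auto intro!: holomorphic_intros continuous_intros\<close>)
  have c: "0 \<le> c"
    using circle[of 1] order_trans[OF norm_ge_zero] by auto
  show ?thesis
  proof (cases "cmod x \<le> 1")
    case True
    then show ?thesis
      using disc[OF circle True] by (simp add: max_absorb1)
  next
    case False
    then have x: "x \<noteq> 0" and x1: "1 < cmod x"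
      by auto
    have "cmod (poly (reflect_poly p) (inverse x)) \<le> c"
    proof (rule disc)
      fix w :: complex assume w: "cmod w = 1"
      then have "w \<noteq> 0" by auto
      then show "cmod (poly (reflect_poly p) w) \<le> c"
        using circle[of "inverse w"] w by (simp add: poly_reflect_poly_nz norm_mult norm_power norm_inverse)
    qed (use x1 in \<open>simp add: norm_inverse inverse_le_1_iff\<close>)
    then have "cmod (poly p x) / cmod x ^ degree p \<le> c"
      using x by (simp add: poly_reflect_poly_nz norm_mult norm_power norm_inverse norm_divide field_simps)
    then have "cmod (poly p x) \<le> c * cmod x ^ degree p"
      using x by (subst (asm) pos_divide_le_eq) auto
    also have "\<dots> \<le> c * cmod x ^ N"
      using deg x1 c by (intro mult_left_mono power_increasing) auto
    finally show ?thesis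
      using x1 by simp
  qed
qed

section \<open>Conjugate reciprocal polynomials on the unit circle\<close>

lemma coeff_conj_reciprocal:
  "coeff (conj_reciprocal p) k = (if k \<le> degree p then cnj (coeff p (degree p - k)) else 0)"
  by (simp add: conj_reciprocal_def coeff_sum)

lemma degree_conj_reciprocal_le: "degree (conj_reciprocal p) \<le> degree p"
  by (rule degree_le) (simp add: coeff_conj_reciprocal)

lemma poly_conj_reciprocal_unit_circle:
  assumes "cmod w = 1"
  shows "poly (conj_reciprocal p) w = w ^ degree p * cnj (poly p w)"
proof -
  let ?n = "degree p"
  have w: "w * cnj w = 1"
    using assms complex_norm_square[of w] by simp
  have pow: "c * w ^ k = w ^ ?n * (c * cnj w ^ (?n - k))" if "k \<le> ?n" for c k
  proof -
    have "w ^ ?n * cnj w ^ (?n - k) = w ^ k * (w ^ (?n - k) * cnj w ^ (?n - k))"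
      using that by (simp flip: power_add mult.assoc)
    then have "w ^ ?n * cnj w ^ (?n - k) = w ^ k"
      by (simp add: w flip: power_mult_distrib)
    then show ?thesis
      by (metis mult.left_commute)
  qed
  have "poly (conj_reciprocal p) w = (\<Sum>k\<le>?n. cnj (coeff p (?n - k)) * w ^ k)"
    by (simp add: conj_reciprocal_def poly_sum poly_monom)
  also have "\<dots> = (\<Sum>k\<le>?n. w ^ ?n * (cnj (coeff p (?n - k)) * cnj w ^ (?n - k)))"
    by (rule sum.cong) (simp_all only: pow atMost_iff)
  also have "\<dots> = (\<Sum>k\<le>?n. w ^ ?n * (cnj (coeff p k) * cnj w ^ k))"
    by (rule sum.reindex_bij_witness[of _ "\<lambda>k. ?n - k" "\<lambda>k. ?n - k"]) auto
  also have "\<dots> = w ^ ?n * cnj (poly p w)"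
    by (simp add: poly_altdef sum_distrib_left)
  finally show ?thesis .
qed

subsection \<open>Zero-free annuli and local exponential behaviour\<close>

lemma max_1_power: "max 1 x ^ n = max 1 (x ^ n)" if "0 \<le> x" for x :: real
  using that one_le_power[of x n] power_le_one[of x n] by (cases "x \<le> 1") (auto simp: max_def)

text \<open>On the unit circle \<open>p w * conj_reciprocal p w = w ^ n * (cmod (p w))\<^sup>2\<close>, so flatness says that the
  polynomial \<open>p * conj_reciprocal p - K z ^ n\<close> is small there, and hence also nearby.\<close>

lemma flat_poly_nonzero_annulus:
  fixes p :: "complex poly"
  assumes deg: "degree p = n" and K: "0 \<le> K"
    and flat: "\<And>w. cmod w = 1 \<Longrightarrow> \<bar>(cmod (poly p w))\<^sup>2 - K\<bar> \<le> \<delta>"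
    and R: "0 \<le> R" "exp (- R) \<le> cmod x ^ n" "cmod x ^ n \<le> exp R"
    and small: "\<delta> * exp (3 * R) < K"
  shows "poly p x \<noteq> 0"
proof
  assume zero: "poly p x = 0"
  define q where "q = p * conj_reciprocal p - monom (complex_of_real K) n"
  have \<delta>: "0 \<le> \<delta>"
    using flat[of 1] by simp
  have "degree (p * conj_reciprocal p) \<le> 2 * n"
    using degree_mult_le[of p "conj_reciprocal p"] degree_conj_reciprocal_le[of p] deg by simp
  then have degq: "degree q \<le> 2 * n"
    unfolding q_def by (intro degree_diff_le) (auto intro: order_trans[OF degree_monom_le])
  have "cmod (poly q w) \<le> \<delta>" if w: "cmod w = 1" for w
  proof -
    have "poly q w = w ^ n * complex_of_real ((cmod (poly p w))\<^sup>2 - K)"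
      using poly_conj_reciprocal_unit_circle[OF w, of p] deg complex_norm_square[of "poly p w"]
      by (simp add: q_def poly_monom algebra_simps)
    then show ?thesis
      using flat[OF w] w by (simp only: norm_mult norm_power norm_of_real) simp
  qed
  then have "cmod (poly q x) \<le> \<delta> * (max 1 (cmod x)) ^ (2 * n)"
    by (rule poly_unit_circle_growth[OF degq])
  also have "(max 1 (cmod x)) ^ (2 * n) = (max 1 (cmod x ^ n))\<^sup>2"
    by (simp add: power_mult mult.commute[of 2] flip: max_1_power)
  also have "\<delta> * (max 1 (cmod x ^ n))\<^sup>2 \<le> \<delta> * (exp R)\<^sup>2"
    using R \<delta> by (intro mult_left_mono power_mono) auto
  also have "(exp R)\<^sup>2 = exp (2 * R)"
    by (simp add: exp_double)
  \<comment> \<open>At a zero of \<open>p\<close> only the monomial of \<open>q\<close> remains.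
    Together with \<open>exp (- R) \<le> cmod x ^ n\<close> this gives
    \<open>K \<le> \<delta> * exp (3 * R)\<close>, hence the exponent in
    \<open>small\<close>.\<close>
  finally have "K * cmod x ^ n \<le> \<delta> * exp (2 * R)"
    using zero K by (simp add: q_def poly_monom norm_mult norm_power)
  moreover have "K * exp (- R) \<le> K * cmod x ^ n"
    using R K by (intro mult_left_mono) auto
  ultimately have "K * exp (- R) * exp R \<le> \<delta> * exp (2 * R) * exp R"
    by (intro mult_right_mono) auto
  then show False
    using small by (simp add: mult.assoc flip: exp_add)
qed

text \<open>The map \<open>z \<mapsto> w * exp (\<i> * R / n * z)\<close> carries the unit disc into
  the zero-free annulus. The product of the values at \<open>z\<close> and \<open>- z\<close> is
  therefore an even nonvanishing function, which is evaluated at \<open>z = s / R\<close>.\<close>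

lemma flat_poly_symmetric_product:
  fixes p :: "complex poly"
  assumes deg: "degree p = n" and n: "0 < n" and K: "0 < K"
    and lower: "\<And>w. cmod w = 1 \<Longrightarrow> (1 - \<epsilon>) * sqrt K \<le> cmod (poly p w)"
    and upper: "\<And>w. cmod w = 1 \<Longrightarrow> cmod (poly p w) \<le> (1 + \<epsilon>) * sqrt K"
    and \<epsilon>: "0 < \<epsilon>" "\<epsilon> \<le> 1 / 4" "3 * \<epsilon> * exp (3 * R) < 1"
    and s: "\<bar>s\<bar> < R" and w: "cmod w = 1"
  obtains u where
    "poly p (w * exp (\<i> * s / n)) * poly p (w * exp (- (\<i> * s / n))) = (poly p w)\<^sup>2 * exp u"
    "cmod u \<le> 2 * (2 * R + 2) * (s / R)\<^sup>2 / (1 - (s / R)\<^sup>2)"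
proof -
  have R: "0 < R"
    using s by linarith
  define G where "G z = poly p (w * exp (\<i> * R / n * z))" for z
  have sqrt_pos: "0 < sqrt K"
    using K by simp
  have "0 < (1 - \<epsilon>) * sqrt K"
    using \<epsilon> sqrt_pos by simp
  then have pw: "poly p w \<noteq> 0"
    using lower[OF w] by auto
  have modn: "cmod (w * exp (\<i> * R / n * z)) ^ n = exp (- (R * Im z))" for z
    using n w by (simp add: norm_mult flip: exp_of_nat_mult)
  have Im: "\<bar>R * Im z\<bar> \<le> R" if "norm z < 1" for z
  proof -
    have "\<bar>Im z\<bar> \<le> 1"
      using abs_Im_le_cmod[of z] that by linarith
    then show ?thesis
      using R by (simp add: abs_mult)
  qed
  \<comment> \<open>Since \<open>\<epsilon> \<le> 1\<close>, the squares of
    \<open>1 + \<epsilon>\<close> and \<open>1 - \<epsilon>\<close> lie within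
    \<open>3 * \<epsilon>\<close> of 1.\<close>
  have square_flat: "\<bar>(cmod (poly p w))\<^sup>2 - K\<bar> \<le> 3 * \<epsilon> * K" if w: "cmod w = 1" for w
  proof -
    have "(cmod (poly p w))\<^sup>2 \<le> ((1 + \<epsilon>) * sqrt K)\<^sup>2"
      using upper[OF w] by (intro power_mono) auto
    also have "\<dots> = (1 + 2 * \<epsilon> + \<epsilon> * \<epsilon>) * K"
      using K by (simp add: power_mult_distrib power2_sum) (simp add: power2_eq_square)
    also have "\<dots> \<le> (1 + 3 * \<epsilon>) * K"
      using K \<epsilon> mult_right_mono[of \<epsilon> 1 \<epsilon>] by (intro mult_right_mono) auto
    finally have 1: "(cmod (poly p w))\<^sup>2 \<le> (1 + 3 * \<epsilon>) * K" .
    have "(1 - 3 * \<epsilon>) * K \<le> (1 - 2 * \<epsilon> + \<epsilon> * \<epsilon>) * K"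
      using K \<epsilon> by (intro mult_right_mono) auto
    also have "\<dots> = ((1 - \<epsilon>) * sqrt K)\<^sup>2"
      using K by (simp add: power_mult_distrib power2_diff) (simp add: power2_eq_square)
    also have "\<dots> \<le> (cmod (poly p w))\<^sup>2"
      using lower[OF w] \<epsilon> K by (intro power_mono) auto
    finally show ?thesis
      using 1 by (simp add: algebra_simps abs_le_iff)
  qed
  have G_nz: "G z \<noteq> 0" if z: "norm z < 1" for z
    unfolding G_def
  proof (rule flat_poly_nonzero_annulus[OF deg _ square_flat])
    show "3 * \<epsilon> * K * exp (3 * R) < K"
      using mult_strict_right_mono[OF \<epsilon>(3) K] by (simp add: mult_ac)
  qed (use Im[OF z] R K in \<open>auto simp only: modn exp_le_cancel_iff\<close>)
  have G_le: "norm (G z) \<le> (1 + \<epsilon>) * sqrt K * exp R" if z: "norm z < 1" for z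
  proof -
    let ?x = "w * exp (\<i> * R / n * z)"
    have "norm (G z) \<le> (1 + \<epsilon>) * sqrt K * (max 1 (cmod ?x)) ^ n"
      unfolding G_def by (rule poly_unit_circle_growth[OF _ upper]) (use deg in auto)
    also have "(max 1 (cmod ?x)) ^ n \<le> exp R"
      using modn[of z] Im[OF z] R by (simp add: max_1_power)
    finally show ?thesis
      using \<epsilon> K by (simp add: mult_left_mono)
  qed
  define F where "F z = G z * G (- z) / (poly p w)\<^sup>2" for z
  \<comment> \<open>The two factors of \<open>G\<close> contribute \<open>exp (2 * R)\<close>. The
    extra \<open>exp 2\<close> absorbs the squared ratio of \<open>1 + \<epsilon>\<close> to
    \<open>1 - \<epsilon>\<close>, because \<open>25 / 16 < 3 * 9 / 16\<close> and
    \<open>3 \<le> exp 2\<close>.\<close>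
  have F_less: "norm (F z) < exp (2 * R + 2)" if z: "norm z < 1" for z
  proof -
    have "norm (G z) * norm (G (- z)) \<le> ((1 + \<epsilon>) * sqrt K * exp R)\<^sup>2"
      unfolding power2_eq_square
      using G_le[OF z] G_le[of "- z"] z \<epsilon> K by (intro mult_mono) auto
    also have "\<dots> = ((1 + \<epsilon>) * sqrt K)\<^sup>2 * exp (2 * R)"
      by (simp add: power_mult_distrib exp_double)
    also have "\<dots> < ((1 - \<epsilon>) * sqrt K)\<^sup>2 * exp 2 * exp (2 * R)"
    proof (rule mult_strict_right_mono)
      have "(1 + \<epsilon>)\<^sup>2 \<le> (5 / 4)\<^sup>2"
        using \<epsilon> by (intro power_mono) auto
      also have "\<dots> < (3 / 4)\<^sup>2 * (3::real)"
        by (simp add: power2_eq_square)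
      also have "\<dots> \<le> (1 - \<epsilon>)\<^sup>2 * exp 2"
        using \<epsilon> exp_ge_add_one_self[of 2] by (intro mult_mono power_mono) auto
      finally show "((1 + \<epsilon>) * sqrt K)\<^sup>2 < ((1 - \<epsilon>) * sqrt K)\<^sup>2 * exp 2"
        using K by (simp add: power_mult_distrib)
    qed simp
    also have "\<dots> = ((1 - \<epsilon>) * sqrt K)\<^sup>2 * exp (2 * R + 2)"
      by (simp add: exp_add)
    also have "\<dots> \<le> (cmod (poly p w))\<^sup>2 * exp (2 * R + 2)"
      using lower[OF w] \<epsilon> K by (intro mult_right_mono power_mono) auto
    finally show ?thesis
      using pw by (simp add: F_def norm_mult norm_divide norm_power pos_divide_less_eq mult.commute)
  qed
  have holF: "F holomorphic_on ball 0 1"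
    unfolding F_def G_def using pw by (intro holomorphic_intros) auto
  have F0: "F 0 = 1"
    using pw by (simp add: F_def G_def power2_eq_square)
  have F_even: "F (- z) = F z" for z
    by (simp add: F_def mult.commute)
  have F_nz: "F z \<noteq> 0" if "norm z < 1" for z
    using G_nz[of z] G_nz[of "- z"] that pw by (simp add: F_def)
  have sR: "norm (complex_of_real (s / R)) < 1"
    using s R by (simp only: norm_of_real) simp
  obtain u where u: "F (s / R) = exp u"
    "norm u \<le> 2 * (2 * R + 2) * (norm (complex_of_real (s / R)))\<^sup>2 / (1 - (norm (complex_of_real (s / R)))\<^sup>2)"
    by (rule even_nonvanishing_close_to_1[OF holF F0 F_even F_nz F_less sR])
  show thesis
  proof (rule that)
    show "poly p (w * exp (\<i> * s / n)) * poly p (w * exp (- (\<i> * s / n))) = (poly p w)\<^sup>2 * exp u"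
      using u(1) pw R by (simp add: F_def G_def field_simps)
    show "cmod u \<le> 2 * (2 * R + 2) * (s / R)\<^sup>2 / (1 - (s / R)\<^sup>2)"
      using u(2) by (simp only: norm_of_real power2_abs)
  qed
qed

section \<open>Uniform estimates for ultraflat sequences\<close>

lemma ultraflat_circle:
  assumes "ultraflat P"
  obtains \<epsilon> :: "nat \<Rightarrow> real" where "\<epsilon> \<longlonglongrightarrow> 0" and "\<And>n. 1 \<le> n \<Longrightarrow> 0 < \<epsilon> n"
    and "\<And>n w. 1 \<le> n \<Longrightarrow> cmod w = 1 \<Longrightarrow> (1 - \<epsilon> n) * sqrt (n + 1) \<le> cmod (poly (P n) w)"
    and "\<And>n w. 1 \<le> n \<Longrightarrow> cmod w = 1 \<Longrightarrow> cmod (poly (P n) w) \<le> (1 + \<epsilon> n) * sqrt (n + 1)"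
proof -
  obtain \<epsilon> :: "nat \<Rightarrow> real" where \<epsilon>: "\<epsilon> \<longlonglongrightarrow> 0" "\<And>n. 1 \<le> n \<Longrightarrow> 0 < \<epsilon> n"
    "\<And>n t. 1 \<le> n \<Longrightarrow> (1 - \<epsilon> n) * sqrt (real n + 1) \<le> cmod (poly (P n) (exp (\<i> * complex_of_real t)))"
    "\<And>n t. 1 \<le> n \<Longrightarrow> cmod (poly (P n) (exp (\<i> * complex_of_real t))) \<le> (1 + \<epsilon> n) * sqrt (real n + 1)"
    using assms unfolding ultraflat_def by blast
  have "w = exp (\<i> * complex_of_real (Arg w))" if "cmod w = 1" for w
  proof -
    have "w = cmod w * exp (\<i> * complex_of_real (Arg w))"
      using that by (intro Arg_eq) auto
    also have "\<dots> = exp (\<i> * complex_of_real (Arg w))"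
      by (simp only: that of_real_1 mult_1)
    finally show ?thesis .
  qed
  then show thesis
    using that[OF \<epsilon>(1,2)] \<epsilon>(3,4) by (metis add.commute of_nat_Suc plus_1_eq_Suc)
qed

text \<open>The coefficient at index \<open>n\<close> has modulus 1, so the degree is exactly
  \<open>n\<close>. Hence \<open>conj_reciprocal\<close>, which reflects about the actual degree,
  reflects \<open>P n\<close> about \<open>n\<close>.\<close>

lemma ultraflat_coeff:
  assumes "ultraflat P" and "1 \<le> n"
  shows "degree (P n) = n" and "\<And>k. k \<le> n \<Longrightarrow> cmod (coeff (P n) k) = 1"
proof -
  have P: "degree (P n) \<le> n" "\<And>k. k \<le> n \<Longrightarrow> cmod (coeff (P n) k) = 1"
    using assms by (auto simp: ultraflat_def unimodular_polys_def)
  then have "coeff (P n) n \<noteq> 0"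
    by (metis norm_zero order_refl zero_neq_one)
  then show "degree (P n) = n"
    using P(1) le_degree by (metis order_antisym)
qed (use assms in \<open>auto simp: ultraflat_def unimodular_polys_def\<close>)

text \<open>The order of choices matters: \<open>R\<close> is fixed first, large in terms of
  \<open>s\<close> and \<open>\<eta>\<close>, and only then is \<open>n\<close> taken so large that
  \<open>3 * \<epsilon> n * exp (3 * R) < 1\<close>.\<close>

lemma ultraflat_symmetric_product:
  fixes s :: real
  assumes P: "ultraflat P" and "0 < \<eta>"
  shows "\<forall>\<^sub>F n in sequentially. \<forall>w. cmod w = 1 \<longrightarrow>
    cmod (poly (P n) (w * exp (\<i> * s / n)) * poly (P n) (w * exp (- (\<i> * s / n))) - (poly (P n) w)\<^sup>2)
      \<le> \<eta> * (real n + 1)"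
proof -
  obtain \<epsilon> :: "nat \<Rightarrow> real" where \<epsilon>: "\<epsilon> \<longlonglongrightarrow> 0" "\<And>n. 1 \<le> n \<Longrightarrow> 0 < \<epsilon> n"
    and lower: "\<And>n w. 1 \<le> n \<Longrightarrow> cmod w = 1 \<Longrightarrow> (1 - \<epsilon> n) * sqrt (n + 1) \<le> cmod (poly (P n) w)"
    and upper: "\<And>n w. 1 \<le> n \<Longrightarrow> cmod w = 1 \<Longrightarrow> cmod (poly (P n) w) \<le> (1 + \<epsilon> n) * sqrt (n + 1)"
    using ultraflat_circle[OF P] by metis
  have "((\<lambda>u::complex. exp u - 1) \<longlongrightarrow> exp 0 - 1) (at 0)"
    by (intro tendsto_intros)
  then obtain d where d: "0 < d" "\<And>u::complex. u \<noteq> 0 \<Longrightarrow> cmod u < d \<Longrightarrow> cmod (exp u - 1) < \<eta> / 4"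
    using \<open>0 < \<eta>\<close> by (auto simp: LIM_def dest!: spec[of _ "\<eta> / 4"])
  have exp_small: "cmod (exp u - 1) \<le> \<eta> / 4" if "cmod u < d" for u
    using d(2)[of u] that \<open>0 < \<eta>\<close> by (cases "u = 0") auto
  \<comment> \<open>Written in powers of \<open>inverse R\<close>, the bound on \<open>u\<close> is
    seen to decay like \<open>1 / R\<close>.\<close>
  have "((\<lambda>R. (4 * s\<^sup>2 * inverse R + 4 * s\<^sup>2 * (inverse R)\<^sup>2) / (1 - s\<^sup>2 * (inverse R)\<^sup>2))
      \<longlongrightarrow> (4 * s\<^sup>2 * 0 + 4 * s\<^sup>2 * 0\<^sup>2) / (1 - s\<^sup>2 * 0\<^sup>2)) at_top"
    by (intro tendsto_intros tendsto_inverse_0_at_top filterlim_ident) simp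
  moreover have "(4 * s\<^sup>2 * inverse R + 4 * s\<^sup>2 * (inverse R)\<^sup>2) / (1 - s\<^sup>2 * (inverse R)\<^sup>2)
      = 2 * (2 * R + 2) * (s / R)\<^sup>2 / (1 - (s / R)\<^sup>2)" for R
    by (rule arg_cong2[of _ _ _ _ "(/)"]; cases "R = 0") (auto simp: field_simps power2_eq_square)
  ultimately have "((\<lambda>R. 2 * (2 * R + 2) * (s / R)\<^sup>2 / (1 - (s / R)\<^sup>2)) \<longlongrightarrow> 0) at_top"
    by simp
  then have "\<forall>\<^sub>F R in at_top. 2 * (2 * R + 2) * (s / R)\<^sup>2 / (1 - (s / R)\<^sup>2) < d \<and> \<bar>s\<bar> < R"
    using d(1) by (intro eventually_conj order_tendstoD(2) eventually_gt_at_top)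
  then obtain R where R: "2 * (2 * R + 2) * (s / R)\<^sup>2 / (1 - (s / R)\<^sup>2) < d" "\<bar>s\<bar> < R"
    by (auto simp: eventually_at_top_linorder)
  have "\<forall>\<^sub>F n in sequentially. \<epsilon> n < min (1 / 4) (1 / (3 * exp (3 * R)))"
    by (rule order_tendstoD(2)[OF \<epsilon>(1)]) simp
  then show ?thesis
    using eventually_ge_at_top[of 1]
  proof eventually_elim
    case (elim n)
    show ?case
    proof (intro allI impI)
      fix w :: complex assume w: "cmod w = 1"
      have small: "\<epsilon> n \<le> 1 / 4" "3 * \<epsilon> n * exp (3 * R) < 1"
        using elim(1) by (auto simp: field_simps)
      obtain u where u:
        "poly (P n) (w * exp (\<i> * s / n)) * poly (P n) (w * exp (- (\<i> * s / n))) = (poly (P n) w)\<^sup>2 * exp u"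
        "cmod u \<le> 2 * (2 * R + 2) * (s / R)\<^sup>2 / (1 - (s / R)\<^sup>2)"
        by (rule flat_poly_symmetric_product[OF ultraflat_coeff(1)[OF P elim(2)] _ _
              lower[OF elim(2)] upper[OF elim(2)] \<epsilon>(2)[OF elim(2)] small R(2) w])
          (use elim(2) in auto)
      \<comment> \<open>The crude factor 2 bounds the squared modulus by \<open>4 * (n + 1)\<close>,
        which the tolerance \<open>\<eta> / 4\<close> for \<open>exp u - 1\<close>
        compensates.\<close>
      have "(1 + \<epsilon> n) * sqrt (n + 1) \<le> 2 * sqrt (n + 1)"
        using small(1) by (intro mult_right_mono) auto
      with upper[OF elim(2) w] have "cmod (poly (P n) w) \<le> 2 * sqrt (n + 1)"
        by (rule order_trans)
      then have "(cmod (poly (P n) w))\<^sup>2 \<le> (2 * sqrt (n + 1))\<^sup>2"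
        by (intro power_mono) auto
      then have "(cmod (poly (P n) w))\<^sup>2 \<le> 4 * (real n + 1)"
        by (simp add: power_mult_distrib)
      moreover have "cmod (exp u - 1) \<le> \<eta> / 4"
        using u(2) R(1) by (intro exp_small) simp
      ultimately have "cmod ((poly (P n) w)\<^sup>2 * (exp u - 1)) \<le> 4 * (real n + 1) * (\<eta> / 4)"
        unfolding norm_mult norm_power by (intro mult_mono) auto
      then show "cmod (poly (P n) (w * exp (\<i> * s / n)) * poly (P n) (w * exp (- (\<i> * s / n)))
          - (poly (P n) w)\<^sup>2) \<le> \<eta> * (real n + 1)"
        by (simp only: u(1)) (simp add: algebra_simps)
    qed
  qed
qed

subsection \<open>Reflected coefficient products\<close>

text \<open>The nodes \<open>y = 2 k / n - 1\<close> are symmetric under \<open>k \<mapsto> n - k\<close>, and \<open>k\<^sup>2\<close> is a quadratic polynomial in \<open>y\<close>.\<close>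

definition refl_mean :: "(nat \<Rightarrow> complex poly) \<Rightarrow> (real \<Rightarrow> complex) \<Rightarrow> nat \<Rightarrow> complex" where
  "refl_mean P f n =
    (\<Sum>k\<le>n. coeff (P n) k * coeff (P n) (n - k) * f (2 * real k / real n - 1)) / (of_nat n + 1)"

lemma refl_mean_add: "refl_mean P (\<lambda>y. f y + g y) n = refl_mean P f n + refl_mean P g n"
  by (simp add: refl_mean_def ring_distribs sum.distrib add_divide_distrib)

lemma refl_mean_cmult: "refl_mean P (\<lambda>y. c * f y) n = c * refl_mean P f n"
  by (simp add: refl_mean_def sum_distrib_left mult_ac)

lemma refl_mean_sum: "refl_mean P (\<lambda>y. \<Sum>i\<in>I. f i y) n = (\<Sum>i\<in>I. refl_mean P (f i) n)"
proof (induction I rule: infinite_finite_induct)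
  case (insert i I)
  then show ?case by (simp add: refl_mean_add)
qed (simp_all add: refl_mean_def)

lemma cmod_of_nat_plus_1: "cmod (of_nat n + 1) = real n + 1"
  by (metis norm_of_nat of_nat_Suc add.commute)

lemma cmod_refl_mean_le:
  assumes P: "ultraflat P" and n: "1 \<le> n"
  shows "cmod (refl_mean P f n) \<le> (\<Sum>k\<le>n. cmod (f (2 * real k / real n - 1))) / (real n + 1)"
proof -
  have "cmod (\<Sum>k\<le>n. coeff (P n) k * coeff (P n) (n - k) * f (2 * real k / real n - 1))
      \<le> (\<Sum>k\<le>n. cmod (f (2 * real k / real n - 1)))"
    by (rule sum_norm_le) (simp add: norm_mult ultraflat_coeff[OF P n])
  then show ?thesis
    by (simp add: refl_mean_def norm_divide cmod_of_nat_plus_1 divide_right_mono)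
qed

lemma node_bound:
  assumes "k \<le> n" "1 \<le> n"
  shows "\<bar>2 * real k / real n - 1\<bar> \<le> 1"
  using assms by (simp add: abs_le_iff field_simps)

lemma cmod_refl_mean_le_uniform:
  assumes P: "ultraflat P" and n: "1 \<le> n" and f: "\<And>y. \<bar>y\<bar> \<le> 1 \<Longrightarrow> cmod (f y) \<le> B"
  shows "cmod (refl_mean P f n) \<le> B"
proof -
  have "(\<Sum>k\<le>n. cmod (f (2 * real k / real n - 1))) \<le> (\<Sum>k\<le>n. B)"
    by (rule sum_mono) (use node_bound n f in auto)
  also have "\<dots> = B * (real n + 1)"
    by simp
  finally have "(\<Sum>k\<le>n. cmod (f (2 * real k / real n - 1))) / (real n + 1) \<le> B"
    by (simp only: pos_divide_le_eq)
  with cmod_refl_mean_le[OF P n] show ?thesis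
    by (rule order_trans)
qed

text \<open>The symmetric product minus the square is, as a polynomial in \<open>w\<close>, small on
  the circle, hence so is its coefficient of index \<open>n\<close>. The two dilation factors
  combine there to \<open>exp (\<i> * s * (2 * k - n) / n)\<close>, the exponential at the
  node.\<close>

lemma refl_mean_exp_minus_1:
  fixes s :: real
  assumes P: "ultraflat P"
  shows "(refl_mean P (\<lambda>y. exp (\<i> * s * y) - 1)) \<longlonglongrightarrow> 0"
proof (rule tendstoI)
  fix e :: real assume e: "0 < e"
  then have "0 < e / 2" by simp
  from ultraflat_symmetric_product[OF P this, of s]
  show "\<forall>\<^sub>F n in sequentially. dist (refl_mean P (\<lambda>y. exp (\<i> * s * y) - 1) n) 0 < e"
    using eventually_ge_at_top[of 1]
  proof eventually_elim
    case (elim n)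
    define u where "u = exp (\<i> * s / n)"
    define v where "v = exp (- (\<i> * s / n))"
    define F where "F = pcompose (P n) [:0, u:] * pcompose (P n) [:0, v:] - (P n)\<^sup>2"
    have "poly F w = poly (P n) (w * u) * poly (P n) (w * v) - (poly (P n) w)\<^sup>2" for w
      by (simp add: F_def poly_pcompose)
    then have "cmod (coeff F n) \<le> e / 2 * (real n + 1)"
      using elim(1) by (intro coeff_le_of_unit_circle_bound) (simp add: u_def v_def)
    also have "coeff F n = (\<Sum>k\<le>n. coeff (P n) k * coeff (P n) (n - k) *
        (exp (\<i> * s * complex_of_real (2 * real k / real n - 1)) - 1))"
    proof -
      have uv: "u ^ k * v ^ (n - k) = exp (\<i> * s * complex_of_real (2 * real k / real n - 1))"
        if "k \<le> n" for k
        using elim(2) that by (simp add: u_def v_def of_nat_diff field_simps flip: exp_of_nat_mult exp_add)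
      have "coeff F n = (\<Sum>k\<le>n. coeff (P n) k * coeff (P n) (n - k) * (u ^ k * v ^ (n - k) - 1))"
        by (simp add: F_def coeff_mult coeff_pcompose_linear power2_eq_square sum_subtractf[symmetric] algebra_simps)
      also have "\<dots> = (\<Sum>k\<le>n. coeff (P n) k * coeff (P n) (n - k) *
          (exp (\<i> * s * complex_of_real (2 * real k / real n - 1)) - 1))"
        by (intro sum.cong refl) (simp only: uv atMost_iff)
      finally show ?thesis .
    qed
    finally have "cmod (refl_mean P (\<lambda>y. exp (\<i> * s * y) - 1) n) \<le> e / 2"
      unfolding refl_mean_def norm_divide cmod_of_nat_plus_1
      by (simp add: pos_divide_le_eq)
    then show ?case
      using e by simp
  qed
qed

section \<open>Vanishing of the means of \<open>1\<close> and \<open>y ^ 2\<close>\<close>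

lemma card_nat_between_le:
  assumes "finite S" and "\<And>k. k \<in> S \<Longrightarrow> a < real k \<and> real k < b" and "a \<le> b"
  shows "real (card S) \<le> b - a + 1"
proof (cases "S = {}")
  case False
  have "S \<subseteq> {Min S..Max S}"
    using assms(1) by auto
  then have "card S \<le> card {Min S..Max S}"
    by (intro card_mono) auto
  then have "card S \<le> Suc (Max S) - Min S"
    by simp
  moreover have "a < real (Min S)" "real (Max S) < b"
    using assms False by auto
  moreover have "Min S \<le> Max S"
    using assms(1) False by simp
  ultimately show ?thesis
    by (simp add: of_nat_diff)
qed (use assms in simp)

text \<open>The sum is geometric with ratio \<open>exp (\<i> * y)\<close>. As
  \<open>\<bar>y\<bar> \<le> 1 < pi / 2\<close>, the ratio stays at distance at least
  \<open>sin \<delta>\<close> from 1.\<close>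

lemma cmod_exp_sum_le:
  fixes y :: real
  assumes "0 < \<delta>" "\<delta> \<le> \<bar>y\<bar>" "\<bar>y\<bar> \<le> 1"
  shows "cmod (\<Sum>s<M. exp (\<i> * real s * y)) \<le> 2 / sin \<delta>"
proof -
  have pi: "1 < pi / 2"
    using pi_gt3 by simp
  have sin_pos: "0 < sin \<delta>"
    using assms pi by (intro sin_gt_zero) auto
  have "sin \<delta> \<le> sin \<bar>y\<bar>"
    using assms pi by (intro sin_monotone_2pi_le) auto
  also have "\<dots> \<le> \<bar>sin y\<bar>"
    by (simp add: abs_if)
  also have "\<dots> \<le> cmod (exp (\<i> * y) - 1)"
    using abs_Im_le_cmod[of "exp (\<i> * y) - 1"] by (simp add: Im_exp)
  finally have lower: "sin \<delta> \<le> cmod (exp (\<i> * y) - 1)" .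
  then have ne: "exp (\<i> * y) \<noteq> 1"
    using sin_pos by auto
  have "(\<Sum>s<M. exp (\<i> * real s * y)) = (\<Sum>s<M. exp (\<i> * y) ^ s)"
    by (simp add: mult_ac flip: exp_of_nat_mult)
  also have "\<dots> = (exp (\<i> * y) ^ M - 1) / (exp (\<i> * y) - 1)"
    by (rule geometric_sum[OF ne])
  finally have "cmod (\<Sum>s<M. exp (\<i> * real s * y)) = cmod (exp (\<i> * y) ^ M - 1) / cmod (exp (\<i> * y) - 1)"
    by (simp add: norm_divide)
  also have "\<dots> \<le> 2 / sin \<delta>"
    using norm_triangle_ineq4[of "exp (\<i> * y) ^ M" 1] lower sin_pos
    by (intro frac_le) (auto simp: norm_power)
  finally show ?thesis .
qed

text \<open>Since the means of \<open>exp (i s y)\<close> and \<open>1\<close> are asymptotically equal for every \<open>s\<close>, \<open>1\<close> may be replaced by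
  a Dirichlet kernel, which is small in \<open>L\<^sup>1\<close>.\<close>

lemma refl_mean_1:
  assumes P: "ultraflat P"
  shows "(refl_mean P (\<lambda>_. 1)) \<longlonglongrightarrow> 0"
proof (rule tendstoI)
  fix e :: real assume e: "0 < e"
  \<comment> \<open>The tolerance is split into thirds: \<open>2 * \<delta> \<le> e / 3\<close>, and
    one third each for \<open>d n\<close> and \<open>1 / (n + 1)\<close>.\<close>
  define \<delta> where "\<delta> = min 1 (e / 6)"
  have \<delta>: "0 < \<delta>" "\<delta> \<le> 1" "\<delta> \<le> e / 6"
    using e by (auto simp: \<delta>_def)
  have sin_pos: "0 < sin \<delta>"
    using \<delta> pi_gt3 by (intro sin_gt_zero) auto
  obtain M :: nat where M: "2 / (\<delta> * sin \<delta>) < M"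
    using reals_Archimedean2 by blast
  moreover have "0 < 2 / (\<delta> * sin \<delta>)"
    using \<delta> sin_pos by simp
  ultimately have M0: "0 < real M"
    by linarith
  \<comment> \<open>This average of exponentials is at most 1 everywhere and, by the choice of
    \<open>M\<close>, at most \<open>\<delta>\<close> for
    \<open>\<delta> \<le> \<bar>y\<bar> \<le> 1\<close>.\<close>
  define q where "q y = (1 / M) * (\<Sum>s<M. exp (\<i> * real s * complex_of_real y))" for y
  have q1: "cmod (q y) \<le> 1" for y
  proof -
    have "cmod (\<Sum>s<M. exp (\<i> * real s * complex_of_real y)) \<le> (\<Sum>s<M. 1)"
      by (intro sum_norm_le) (simp add: mult.assoc flip: of_real_mult)
    then show ?thesis
      using M0 by (simp add: q_def norm_mult norm_divide)
  qed
  have q2: "cmod (q y) \<le> \<delta>" if "\<delta> \<le> \<bar>y\<bar>" "\<bar>y\<bar> \<le> 1" for y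
  proof -
    have "cmod (q y) = cmod (\<Sum>s<M. exp (\<i> * real s * complex_of_real y)) / M"
      by (simp add: q_def norm_mult norm_divide)
    also have "\<dots> \<le> (2 / sin \<delta>) / M"
      using cmod_exp_sum_le[OF \<delta>(1) that] by (rule divide_right_mono) simp
    also have "\<dots> \<le> \<delta>"
      using M M0 \<delta> sin_pos by (simp add: field_simps)
    finally show ?thesis .
  qed
  have q_mean: "cmod (refl_mean P q n) \<le> 2 * \<delta> + 1 / (real n + 1)" if n: "1 \<le> n" for n
  proof -
    let ?y = "\<lambda>k. 2 * real k / real n - 1"
    let ?S = "{k. k \<le> n \<and> \<bar>?y k\<bar> < \<delta>}"
    have "(\<Sum>k\<le>n. cmod (q (?y k))) \<le> (\<Sum>k\<le>n. \<delta> + (if k \<in> ?S then 1 else 0))"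
    proof (rule sum_mono)
      fix k assume "k \<in> {..n}"
      then show "cmod (q (?y k)) \<le> \<delta> + (if k \<in> ?S then 1 else 0)"
        using q1[of "?y k"] q2[of "?y k"] node_bound[of k n] n \<delta> by (cases "\<bar>?y k\<bar> < \<delta>") auto
    qed
    also have "\<dots> = \<delta> * (real n + 1) + card ?S"
    proof -
      have "(\<Sum>k\<le>n. if k \<in> ?S then 1 else 0 :: real) = (\<Sum>k\<in>{..n} \<inter> ?S. 1)"
        by (simp only: sum.inter_restrict[OF finite_atMost])
      also have "{..n} \<inter> ?S = ?S"
        by auto
      finally show ?thesis
        by (simp add: sum.distrib algebra_simps)
    qed
    \<comment> \<open>The nodes within \<open>\<delta>\<close> of 0 come from an open interval of
      indices of length \<open>n * \<delta>\<close>.\<close>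
    also have "real (card ?S) \<le> n * (1 + \<delta>) / 2 - n * (1 - \<delta>) / 2 + 1"
    proof (rule card_nat_between_le)
      fix k assume "k \<in> ?S"
      then show "n * (1 - \<delta>) / 2 < real k \<and> real k < n * (1 + \<delta>) / 2"
        using n by (simp add: abs_less_iff field_simps)
    qed (use n \<delta> in \<open>auto simp: field_simps\<close>)
    also have "\<delta> * (real n + 1) + (n * (1 + \<delta>) / 2 - n * (1 - \<delta>) / 2 + 1) \<le> 2 * \<delta> * (real n + 1) + 1"
      using \<delta> by (simp add: field_simps)
    finally have "(\<Sum>k\<le>n. cmod (q (?y k))) / (real n + 1) \<le> (2 * \<delta> * (real n + 1) + 1) / (real n + 1)"
      by (simp add: divide_right_mono)
    also have "\<dots> = 2 * \<delta> + 1 / (real n + 1)"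
      by (simp add: field_simps)
    finally show ?thesis
      using cmod_refl_mean_le[OF P n, of q] by linarith
  qed
  \<comment> \<open>\<open>q - 1\<close> is the average of the functions
    \<open>exp (\<i> * s * y) - 1\<close>, and \<open>d\<close> collects their means, each of which
    tends to 0.\<close>
  define d where "d n = complex_of_real (1 / M) * (\<Sum>s<M. refl_mean P (\<lambda>y. exp (\<i> * real s * y) - 1) n)" for n
  have "d \<longlonglongrightarrow> complex_of_real (1 / M) * (\<Sum>s<M. 0)"
    unfolding d_def by (intro tendsto_intros refl_mean_exp_minus_1[OF P])
  then have "d \<longlonglongrightarrow> 0"
    by simp
  moreover have split: "refl_mean P (\<lambda>_. 1) n = refl_mean P q n - d n" for n
  proof -
    have "q y = (1 / M) * (\<Sum>s<M. exp (\<i> * real s * y) - 1) + 1" for y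
      using M0 by (simp add: q_def sum_subtractf field_simps)
    then have "q = (\<lambda>y. (1 / M) * (\<Sum>s<M. exp (\<i> * real s * y) - 1) + 1)"
      by (rule ext)
    then have "refl_mean P q n = d n + refl_mean P (\<lambda>_. 1) n"
      by (simp only: refl_mean_add refl_mean_cmult refl_mean_sum d_def)
    then show ?thesis
      by simp
  qed
  ultimately have "\<forall>\<^sub>F n in sequentially. cmod (d n) < e / 3"
    using e by (auto dest!: tendstoD[of _ _ _ "e / 3"])
  moreover have "\<forall>\<^sub>F n in sequentially. 1 / (real n + 1) < e / 3"
    using order_tendstoD(2)[OF LIMSEQ_inverse_real_of_nat, of "e / 3"] e
    by (simp add: inverse_eq_divide add.commute)
  ultimately show "\<forall>\<^sub>F n in sequentially. dist (refl_mean P (\<lambda>_. 1) n) 0 < e"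
    using eventually_ge_at_top[of 1]
  proof eventually_elim
    case (elim n)
    have "cmod (refl_mean P (\<lambda>_. 1) n) \<le> cmod (refl_mean P q n) + cmod (d n)"
      unfolding split by (rule norm_triangle_ineq4)
    then show ?case
      using q_mean[OF elim(3)] elim(1,2) \<delta>(3) by simp
  qed
qed

text \<open>This is a Taylor remainder of order three. At \<open>x = e * y\<close> the cubic error
  leaves a factor \<open>e\<close> after division by \<open>e ^ 2\<close>.\<close>

lemma cos_quadratic_bound: "\<bar>x\<^sup>2 - 2 * (1 - cos x)\<bar> \<le> \<bar>x\<bar> ^ 3 / 3" for x :: real
proof -
  obtain t where "cos x = (\<Sum>m<3. cos_coeff m * x ^ m) + cos (t + 1/2 * real 3 * pi) / fact 3 * x ^ 3"
    using Maclaurin_cos_expansion[of x 3] by blast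
  then have "x\<^sup>2 - 2 * (1 - cos x) = 2 * (cos (t + 1/2 * real 3 * pi) / fact 3 * x ^ 3)"
    by (simp add: cos_coeff_def eval_nat_numeral)
  also have "\<bar>\<dots>\<bar> = \<bar>cos (t + 1/2 * real 3 * pi)\<bar> * \<bar>x\<bar> ^ 3 / 3"
    by (simp add: abs_mult power_abs fact_numeral)
  also have "\<dots> \<le> 1 * \<bar>x\<bar> ^ 3 / 3"
    by (intro divide_right_mono mult_right_mono) auto
  finally show ?thesis by simp
qed

lemma refl_mean_square:
  assumes P: "ultraflat P"
  shows "(refl_mean P (\<lambda>y. (complex_of_real y)\<^sup>2)) \<longlonglongrightarrow> 0"
proof (rule tendstoI)
  fix e :: real assume e: "0 < e"
  \<comment> \<open>The frequency is the tolerance \<open>e\<close> itself. The two exponentials sum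
    to \<open>2 * cos (e * y)\<close>, so \<open>g\<close> is the error of the cosine approximation
    to \<open>y ^ 2\<close>, at most \<open>e / 3\<close> on the nodes.\<close>
  define g where "g y = (complex_of_real y)\<^sup>2
    + complex_of_real (1 / e\<^sup>2) * ((exp (\<i> * e * y) - 1) + (exp (\<i> * (- e) * y) - 1))" for y :: real
  have g: "cmod (g y) \<le> e / 3" if "\<bar>y\<bar> \<le> 1" for y
  proof -
    have "exp (\<i> * e * y) + exp (\<i> * (- e) * y) = 2 * complex_of_real (cos (e * y))"
      by (simp add: complex_eq_iff Re_exp Im_exp)
    then have "g y = complex_of_real (y\<^sup>2 - 2 * (1 - cos (e * y)) / e\<^sup>2)"
      using e by (simp add: g_def field_simps)
    also have "y\<^sup>2 - 2 * (1 - cos (e * y)) / e\<^sup>2 = ((e * y)\<^sup>2 - 2 * (1 - cos (e * y))) / e\<^sup>2"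
      using e by (simp add: field_simps)
    finally have "cmod (g y) = \<bar>(e * y)\<^sup>2 - 2 * (1 - cos (e * y))\<bar> / e\<^sup>2"
      by (simp only: norm_of_real abs_divide) simp
    also have "\<dots> \<le> (\<bar>e * y\<bar> ^ 3 / 3) / e\<^sup>2"
      by (intro divide_right_mono cos_quadratic_bound) auto
    also have "\<dots> = e * \<bar>y\<bar> ^ 3 / 3"
      using e by (simp add: abs_mult power_mult_distrib eval_nat_numeral)
    also have "\<dots> \<le> e * 1 / 3"
      using that e by (intro divide_right_mono mult_left_mono power_le_one) auto
    finally show ?thesis by simp
  qed
  define d where "d n = complex_of_real (1 / e\<^sup>2) * (refl_mean P (\<lambda>y. exp (\<i> * e * y) - 1) n
    + refl_mean P (\<lambda>y. exp (\<i> * (- e) * y) - 1) n)" for n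
  have "d \<longlonglongrightarrow> complex_of_real (1 / e\<^sup>2) * (0 + 0)"
    unfolding d_def
    using refl_mean_exp_minus_1[OF P, of e] refl_mean_exp_minus_1[OF P, of "- e"]
    by (intro tendsto_intros) auto
  then have "\<forall>\<^sub>F n in sequentially. cmod (d n) < e / 2"
    using e by (auto dest!: tendstoD[of _ _ _ "e / 2"])
  then show "\<forall>\<^sub>F n in sequentially. dist (refl_mean P (\<lambda>y. (complex_of_real y)\<^sup>2) n) 0 < e"
    using eventually_ge_at_top[of 1]
  proof eventually_elim
    case (elim n)
    have "refl_mean P g n = refl_mean P (\<lambda>y. (complex_of_real y)\<^sup>2) n + d n"
      unfolding g_def d_def by (simp only: refl_mean_add refl_mean_cmult of_real_power)
    then have "cmod (refl_mean P (\<lambda>y. (complex_of_real y)\<^sup>2) n) \<le> cmod (refl_mean P g n) + cmod (d n)"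
      using norm_triangle_ineq4[of "refl_mean P g n" "d n"] by simp
    moreover have "cmod (refl_mean P g n) \<le> e / 3"
      by (rule cmod_refl_mean_le_uniform[OF P elim(2) g])
    ultimately show ?case
      using elim(1) e by simp
  qed
qed

text \<open>Replacing \<open>k\<close> by \<open>n - k\<close> negates the node and keeps the
  coefficient product, so the sum equals its own negative.\<close>

lemma refl_mean_odd:
  assumes odd: "\<And>y. f (- y) = - f y" and n: "1 \<le> n"
  shows "refl_mean P f n = 0"
proof -
  let ?t = "\<lambda>k. coeff (P n) k * coeff (P n) (n - k) * f (2 * real k / real n - 1)"
  have "?t k = - ?t (n - k)" if "k \<le> n" for k
  proof -
    have "2 * real (n - k) / real n - 1 = - (2 * real k / real n - 1)"
      using that n by (simp add: of_nat_diff field_simps)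
    then show ?thesis
      using that by (simp only: odd) simp
  qed
  then have "(\<Sum>k\<le>n. ?t k) = (\<Sum>k\<le>n. - ?t (n - k))"
    by (intro sum.cong) auto
  also have "\<dots> = (\<Sum>k\<le>n. - ?t k)"
    by (rule sum.reindex_bij_witness[of _ "\<lambda>k. n - k" "\<lambda>k. n - k"]) auto
  finally have "(\<Sum>k\<le>n. ?t k) = 0"
    by (simp add: sum_negf)
  then show ?thesis
    by (simp add: refl_mean_def)
qed

text \<open>At the node \<open>y\<close> of index \<open>k\<close> one has
  \<open>(k / n) ^ 2 = (1 + y) ^ 2 / 4\<close>, which reduces the moment to the means of
  \<open>1\<close>, \<open>y\<close> and \<open>y ^ 2\<close>.\<close>

lemma ultraflat_second_moment:
  assumes P: "ultraflat P"
  shows "(\<lambda>n. (\<Sum>k\<le>n. (of_nat k)\<^sup>2 * (coeff (P n) k * coeff (P n) (n - k)))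
    / ((of_nat n)\<^sup>2 * (of_nat n + 1))) \<longlonglongrightarrow> 0"
proof -
  let ?m = "\<lambda>n. 1 / 4 * (refl_mean P (\<lambda>_. 1) n + refl_mean P (\<lambda>y. (complex_of_real y)\<^sup>2) n)"
  have "?m \<longlonglongrightarrow> 1 / 4 * (0 + 0)"
    by (intro tendsto_intros refl_mean_1 refl_mean_square P)
  moreover have "\<forall>\<^sub>F n in sequentially. ?m n =
      (\<Sum>k\<le>n. (of_nat k)\<^sup>2 * (coeff (P n) k * coeff (P n) (n - k))) / ((of_nat n)\<^sup>2 * (of_nat n + 1))"
    using eventually_ge_at_top[of 1]
  proof eventually_elim
    case (elim n)
    have "refl_mean P complex_of_real n = 0"
      by (rule refl_mean_odd) (use elim in auto)
    then have "?m n = 1 / 4 * ((refl_mean P (\<lambda>_. 1) n + refl_mean P (\<lambda>y. (complex_of_real y)\<^sup>2) n)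
        + 2 * refl_mean P complex_of_real n)"
      by simp
    also have "\<dots> = refl_mean P (\<lambda>y. 1 / 4 * ((1 + (complex_of_real y)\<^sup>2) + 2 * complex_of_real y)) n"
      by (simp only: refl_mean_add refl_mean_cmult)
    also have "\<dots> = (\<Sum>k\<le>n. (1 / (of_nat n)\<^sup>2) * ((of_nat k)\<^sup>2 * (coeff (P n) k * coeff (P n) (n - k)))) / (of_nat n + 1)"
      unfolding refl_mean_def using elim
      by (intro arg_cong2[of _ _ _ _ "(/)"] sum.cong) (auto simp: field_simps power2_eq_square)
    finally show ?case
      by (simp only: sum_distrib_left[symmetric]) simp
  qed
  ultimately have "(\<lambda>n. (\<Sum>k\<le>n. (of_nat k)\<^sup>2 * (coeff (P n) k * coeff (P n) (n - k)))
    / ((of_nat n)\<^sup>2 * (of_nat n + 1))) \<longlonglongrightarrow> 1 / 4 * (0 + 0)"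
    by (rule Lim_transform_eventually)
  then show ?thesis
    by simp
qed

section \<open>Expansion of the square and the asymptotics\<close>

lemma cmod_diff_cnj_square:
  assumes "cmod a = 1" "cmod b = 1"
  shows "(cmod (a - cnj b))\<^sup>2 = 2 - 2 * Re (a * b)"
proof -
  have "(Re a)\<^sup>2 + (Im a)\<^sup>2 = 1" "(Re b)\<^sup>2 + (Im b)\<^sup>2 = 1"
    using assms by (simp_all flip: cmod_power2)
  then show ?thesis
    unfolding cmod_power2 by (simp add: power2_diff power2_sum algebra_simps)
qed

lemma sum_squares_nat: "(\<Sum>k\<le>n. (real k)\<^sup>2) = real n * (real n + 1) * (2 * real n + 1) / 6"
  by (induction n) (auto simp: field_simps power2_eq_square)

lemma Re_of_nat_square_mult: "Re ((of_nat k)\<^sup>2 * z) = (real k)\<^sup>2 * Re z"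
  by (simp add: power2_eq_square)

theorem theorem2p3:
  fixes P :: "nat \<Rightarrow> complex poly"
  assumes "ultraflat P"
  shows "(\<forall>n\<ge>1.
      (\<Sum>k=0..n. (real k)\<^sup>2 * (cmod (coeff (P n) k - cnj (coeff (P n) (n - k))))\<^sup>2)
      = 1 / (2 * pi) * integral {0..2 * pi} (\<lambda>t.
          (cmod (poly (pderiv (P n) - pderiv (conj_reciprocal (P n)))
            (exp (\<i> * complex_of_real t))))\<^sup>2))
    \<and> (\<lambda>n. 1 / (2 * pi) * integral {0..2 * pi} (\<lambda>t.
          (cmod (poly (pderiv (P n) - pderiv (conj_reciprocal (P n)))
            (exp (\<i> * complex_of_real t))))\<^sup>2))
      \<sim>[sequentially] (\<lambda>n. 2 * (real n) ^ 3 / 3)"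
    (is "(\<forall>n\<ge>1. ?S n = ?I n) \<and> ?I \<sim>[sequentially] ?g")
proof
  show eq: "\<forall>n\<ge>1. ?S n = ?I n"
  proof (intro allI impI)
    fix n :: nat assume n: "1 \<le> n"
    then obtain m where m: "n = Suc m"
      by (cases n) auto
    let ?p = "pderiv (P n) - pderiv (conj_reciprocal (P n))"
    note deg = ultraflat_coeff(1)[OF assms n]
    \<comment> \<open>Differentiation lowers the degree to \<open>m = n - 1\<close>, and coefficient
      \<open>k\<close> of the derivative comes from index \<open>Suc k\<close>.\<close>
    have "degree ?p \<le> m"
      using degree_conj_reciprocal_le[of "P n"] deg m
      by (intro degree_diff_le) (auto simp: degree_pderiv)
    then have "?I n = (\<Sum>k\<le>m. (cmod (coeff ?p k))\<^sup>2)"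
      using integral_unique[OF parseval_poly[of ?p m]] by simp
    also have "\<dots> = (\<Sum>k\<le>m. (real (Suc k))\<^sup>2 * (cmod (coeff (P n) (Suc k) - cnj (coeff (P n) (n - Suc k))))\<^sup>2)"
    proof (rule sum.cong)
      fix k assume "k \<in> {..m}"
      then have "coeff ?p k = of_nat (Suc k) * (coeff (P n) (Suc k) - cnj (coeff (P n) (n - Suc k)))"
        using deg m by (simp add: coeff_pderiv coeff_conj_reciprocal algebra_simps)
      then show "(cmod (coeff ?p k))\<^sup>2
          = (real (Suc k))\<^sup>2 * (cmod (coeff (P n) (Suc k) - cnj (coeff (P n) (n - Suc k))))\<^sup>2"
        by (simp only: norm_mult norm_of_nat power_mult_distrib)
    qed simp
    \<comment> \<open>Shifting the index back only adds the term at 0, which has weight 0.\<close>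
    also have "\<dots> = ?S n"
      unfolding m by (subst sum.atLeast0_atMost_Suc_shift) (simp add: atMost_atLeast0)
    finally show "?S n = ?I n" ..
  qed
  define c where "c n = (\<Sum>k\<le>n. (of_nat k)\<^sup>2 * (coeff (P n) k * coeff (P n) (n - k)))
    / ((of_nat n)\<^sup>2 * (of_nat n + 1))" for n
  have c: "c \<longlonglongrightarrow> 0"
    unfolding c_def by (rule ultraflat_second_moment[OF assms])
  show "?I \<sim>[sequentially] ?g"
  proof (rule asymp_equivI')
    \<comment> \<open>These are the two parts of \<open>?I n / ?g n\<close>: the sum of squares
      supplies the first product, the cross term the multiple of \<open>Re (c n)\<close>.\<close>
    have "(\<lambda>n. (1 + inverse (real n)) * (1 + inverse (real n) / 2) - 3 * (1 + inverse (real n)) * Re (c n))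
        \<longlonglongrightarrow> (1 + 0) * (1 + 0 / 2) - 3 * (1 + 0) * Re 0"
      by (intro tendsto_intros lim_inverse_n c) simp
    moreover have "\<forall>\<^sub>F n in sequentially. (1 + inverse (real n)) * (1 + inverse (real n) / 2)
        - 3 * (1 + inverse (real n)) * Re (c n) = ?I n / ?g n"
      using eventually_ge_at_top[of 1]
    proof eventually_elim
      case (elim n)
      let ?t = "\<Sum>k\<le>n. (of_nat k)\<^sup>2 * (coeff (P n) k * coeff (P n) (n - k))"
      have "?I n = ?S n"
        by (rule eq[rule_format, OF elim, symmetric])
      also have "\<dots> = (\<Sum>k\<le>n. (real k)\<^sup>2 * (2 - 2 * Re (coeff (P n) k * coeff (P n) (n - k))))"
        by (rule sum.cong) (auto simp: cmod_diff_cnj_square ultraflat_coeff[OF assms elim] atMost_atLeast0)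
      also have "\<dots> = 2 * (\<Sum>k\<le>n. (real k)\<^sup>2) - 2 * Re ?t"
      proof -
        have "Re ?t = (\<Sum>k\<le>n. (real k)\<^sup>2 * Re (coeff (P n) k * coeff (P n) (n - k)))"
          unfolding Re_sum by (intro sum.cong refl) (simp only: Re_of_nat_square_mult)
        then show ?thesis
          by (simp only: sum_distrib_left sum_subtractf[symmetric]) (simp add: algebra_simps)
      qed
      also have "?t = complex_of_real ((real n)\<^sup>2 * (real n + 1)) * c n"
      proof -
        have "complex_of_nat n + 1 \<noteq> 0"
          by (metis add.commute of_nat_Suc of_nat_neq_0)
        then show ?thesis
          using elim by (simp add: c_def)
      qed
      also have "Re \<dots> = (real n)\<^sup>2 * (real n + 1) * Re (c n)"
        by (simp only: times_complex.sel Re_complex_of_real Im_complex_of_real mult_zero_left diff_zero)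
      finally have I: "?I n = 2 * (real n * (real n + 1) * (2 * real n + 1) / 6)
          - 2 * ((real n)\<^sup>2 * (real n + 1) * Re (c n))"
        by (simp only: sum_squares_nat)
      show ?case
        unfolding I using elim by (simp add: field_simps power2_eq_square power3_eq_cube)
    qed
    ultimately show "(\<lambda>n. ?I n / ?g n) \<longlonglongrightarrow> 1"
      by (simp add: Lim_transform_eventually)
  qed
qed

end
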